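(* Let $a,b$ be row vectors of length $n$ with entries in $\mathbb{R}_{\max}$, both different from the vector $-\infty$, such that $a\not\geq b$ and there exists $i\in[n]$ with $a_i\geq b_i$, and consider the closed half-space $H=\{h\in\mathbb{R}_{\max}^n\mid ah\geq bh\}$. (For $a,b\neq-\infty$, these two conditions on $a$ and $b$ are together equivalent to $\{-\infty\}\neq H\neq\mathbb{R}_{\max}^n$.) Define row vectors $a',b'$ with entries in $\mathbb{R}_{\max}$ by $$a'_i=\begin{cases}a_i&\text{if }a_i\geq b_i\\-\infty&\text{if }a_i<b_i,\end{cases}\qquad b'_j=\begin{cases}b_j&\text{if }a_j<b_j\\-\infty&\text{if }a_j\geq b_j.\end{cases}$$ Then $\operatorname{Supp} a'\cap\operatorname{Supp} b'=\emptyset$, and $$H=\{h\in\mathbb{R}_{\max}^n\mid a'h\geq b'h\}.$$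
   Context: $\mathbb{R}_{\max}=\mathbb{R}\cup\{-\infty\}$ with addition $\oplus=\max$ and multiplication $\otimes=+$; $[n]=\{1,\dots,n\}$. For a row vector $a$ and a column vector $h\in\mathbb{R}_{\max}^n$, $ah:=\max_{i\in[n]}(a_i+h_i)$. $\operatorname{Supp} a:=\{i\in[n]\mid a_i\in\mathbb{R}\}$. Vectors are ordered entrywise; $-\infty$ also denotes the vector with all entries $-\infty$. *)

theory Defs
  imports "HOL-Analysis.Analysis"
begin

text \<open>
  The max-plus semiring is carried by the extended reals other than \<^term>\<open>\<infinity> :: ereal\<close>:
  on this set \<^term>\<open>max :: ereal \<Rightarrow> ereal \<Rightarrow> ereal\<close> is the semiring addition, and extended real
  addition, for which \<^term>\<open>- \<infinity> :: ereal\<close> is absorbing there, is the semiring multiplication.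
\<close>

definition Rmax :: "ereal set" where
  "Rmax = {x. x \<noteq> \<infinity>}"

text \<open>
  Row and column vectors share one type; the index type plays the role of \<open>{1..n}\<close>.
  The order on \<^typ>\<open>ereal ^ 'n\<close> is the entrywise one.
\<close>

definition Rmax_vecs :: "(ereal ^ 'n) set" where
  "Rmax_vecs = {h. \<forall>i. h $ i \<in> Rmax}"

definition neg_inf_vec :: "ereal ^ 'n" where
  "neg_inf_vec = (\<chi> i. - \<infinity>)"

definition tprod :: "ereal ^ 'n \<Rightarrow> ereal ^ 'n \<Rightarrow> ereal" where
  "tprod a h = Max (range (\<lambda>i. a $ i + h $ i))"

definition Supp :: "ereal ^ 'n \<Rightarrow> 'n set" where
  "Supp a = {i. a $ i \<in> range ereal}"

definition halfspace :: "ereal ^ 'n \<Rightarrow> ereal ^ 'n \<Rightarrow> (ereal ^ 'n) set" where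
  "halfspace a b = {h \<in> Rmax_vecs. tprod a h \<ge> tprod b h}"

end

theory Submission
  imports Defs
begin

text \<open>
  If \<open>a h \<ge> b h\<close>, then a maximum \<open>a h \<noteq> -\<infinity>\<close> cannot be attained at an index with \<open>a\<^sub>i < b\<^sub>i\<close>, since
  there \<open>b\<^sub>i + h\<^sub>i\<close> would exceed it, so such entries of \<open>a\<close> are irrelevant; where \<open>a\<^sub>i \<ge> b\<^sub>i\<close>, the
  term of \<open>b\<close> is dominated by that of \<open>a\<close>. The max-plus unit vectors detect single entries.
\<close>

lemma tprod_le_iff: "tprod b h \<le> x \<longleftrightarrow> (\<forall>i. b $ i + h $ i \<le> x)"
  unfolding tprod_def by (subst Max_le_iff) auto

lemma tprod_ge: "a $ i + h $ i \<le> tprod a h"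
  unfolding tprod_def by (rule Max_ge) auto

lemma tprod_attained: obtains i where "tprod a h = a $ i + h $ i"
proof -
  have "tprod a h \<in> range (\<lambda>i. a $ i + h $ i)"
    unfolding tprod_def by (rule Max_in) auto
  then show ?thesis using that by auto
qed

lemma tprod_mono: "(\<And>i. a $ i \<le> c $ i) \<Longrightarrow> tprod a h \<le> tprod c h"
  by (meson add_right_mono order_trans tprod_ge tprod_le_iff)

lemma Rmax_vecs_nth: "h \<in> Rmax_vecs \<Longrightarrow> h $ i \<noteq> \<infinity>"
  by (simp add: Rmax_vecs_def Rmax_def)

text \<open>In \<open>ereal\<close>, \<open>\<infinity> + - \<infinity> = \<infinity>\<close>, so
  \<open>- \<infinity>\<close> is absorbing only away from \<open>\<infinity>\<close>.\<close>

lemma add_neg_inf: "x \<noteq> \<infinity> \<Longrightarrow> x + - \<infinity> = (- \<infinity> :: ereal)"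
  by (cases x) auto

lemma neg_inf_vec_in_halfspace:
  assumes "a \<in> Rmax_vecs" and "b \<in> Rmax_vecs"
  shows "neg_inf_vec \<in> halfspace a b"
  using assms
  by (auto simp: halfspace_def tprod_le_iff Rmax_vecs_def Rmax_def neg_inf_vec_def add_neg_inf)

definition unit_vec :: "'n \<Rightarrow> ereal ^ 'n" where
  "unit_vec i = (\<chi> j. if j = i then 0 else - \<infinity>)"

lemma unit_vec_in_Rmax_vecs: "unit_vec i \<in> Rmax_vecs"
  by (simp add: unit_vec_def Rmax_vecs_def Rmax_def)

lemma unit_vec_neq_neg_inf_vec: "unit_vec i \<noteq> neg_inf_vec"
  by (auto simp: unit_vec_def neg_inf_vec_def vec_eq_iff)

text \<open>Off position \<open>i\<close> every term is absorbed to \<open>- \<infinity>\<close>; at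
  \<open>i\<close>, adding \<open>0\<close> leaves the entry as it is.\<close>

lemma tprod_unit_vec:
  assumes "a \<in> Rmax_vecs"
  shows "tprod a (unit_vec i) = a $ i"
proof (rule antisym)
  show "tprod a (unit_vec i) \<le> a $ i"
    using Rmax_vecs_nth[OF assms] by (auto simp: tprod_le_iff unit_vec_def add_neg_inf)
  show "a $ i \<le> tprod a (unit_vec i)"
    using tprod_ge[of a i "unit_vec i"] by (simp add: unit_vec_def)
qed

lemma unit_vec_in_halfspace_iff:
  assumes "a \<in> Rmax_vecs" and "b \<in> Rmax_vecs"
  shows "unit_vec i \<in> halfspace a b \<longleftrightarrow> b $ i \<le> a $ i"
  using assms by (simp add: halfspace_def unit_vec_in_Rmax_vecs tprod_unit_vec)

text \<open>Testing on unit vectors recovers the entrywise order; the converse is monotonicity of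
  \<open>tprod\<close>.\<close>

lemma halfspace_eq_Rmax_vecs_iff:
  assumes "a \<in> Rmax_vecs" and "b \<in> Rmax_vecs"
  shows "halfspace a b = Rmax_vecs \<longleftrightarrow> a \<ge> b"
proof
  assume "halfspace a b = Rmax_vecs"
  then show "a \<ge> b"
    using unit_vec_in_halfspace_iff[OF assms] unit_vec_in_Rmax_vecs
    by (auto simp: less_eq_vec_def)
next
  assume "a \<ge> b"
  then show "halfspace a b = Rmax_vecs"
    by (auto simp: halfspace_def less_eq_vec_def intro: tprod_mono)
qed

lemma tprod_attained_imp_neg_inf:
  assumes h: "h \<in> halfspace a b" and a: "tprod a h = a $ i + h $ i" and "a $ i < b $ i"
  shows "h $ i = - \<infinity>"
proof (rule ccontr)
  assume "h $ i \<noteq> - \<infinity>"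
  moreover have "h $ i \<noteq> \<infinity>"
    using h by (auto simp: halfspace_def dest: Rmax_vecs_nth)
  \<comment> \<open>Adding the finite number \<open>h $ i\<close> preserves strict
    inequality.\<close>
  ultimately have "a $ i + h $ i < b $ i + h $ i"
    using \<open>a $ i < b $ i\<close> by (cases "h $ i"; cases "a $ i"; cases "b $ i") auto
  also have "\<dots> \<le> tprod a h"
    using h by (auto simp: halfspace_def tprod_le_iff)
  finally show False using a by simp
qed

text \<open>Any \<open>i\<close> with \<open>b $ i \<le> a $ i\<close> would put
  \<open>unit_vec i\<close> into the half-space as a second element. Conversely, strict domination
  everywhere forces the maximum \<open>tprod a h\<close> down to \<open>- \<infinity>\<close>, and
  \<open>h\<close> with it.\<close>

lemma halfspace_eq_singleton_iff:
  assumes a: "a \<in> Rmax_vecs" and b: "b \<in> Rmax_vecs"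
  shows "halfspace a b = {neg_inf_vec} \<longleftrightarrow> (\<forall>i. a $ i < b $ i)"
proof
  assume "halfspace a b = {neg_inf_vec}"
  then show "\<forall>i. a $ i < b $ i"
    using unit_vec_in_halfspace_iff[OF assms] unit_vec_neq_neg_inf_vec
    by (metis linorder_not_le singletonD)
next
  assume lt: "\<forall>i. a $ i < b $ i"
  have "h = neg_inf_vec" if h: "h \<in> halfspace a b" for h
  proof -
    obtain i where i: "tprod a h = a $ i + h $ i" by (rule tprod_attained)
    have "tprod a h = - \<infinity>"
      using tprod_attained_imp_neg_inf[OF h i] lt i Rmax_vecs_nth[OF a, of i] by (simp add: add_neg_inf)
    then have "b $ j + h $ j = - \<infinity>" for j
      using h by (auto simp: halfspace_def tprod_le_iff)
    \<comment> \<open>Being strictly above \<open>a $ j\<close>, the entry \<open>b $ j\<close>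
      cannot be \<open>- \<infinity>\<close>, so a sum \<open>- \<infinity>\<close> must come from
      \<open>h $ j\<close>.\<close>
    moreover have "b $ j \<noteq> - \<infinity>" for j
      using lt by (metis ereal_infty_less(2) less_ereal.simps(3) not_less_iff_gr_or_eq)
    ultimately show ?thesis
      by (auto simp: neg_inf_vec_def vec_eq_iff)
  qed
  then show "halfspace a b = {neg_inf_vec}"
    using neg_inf_vec_in_halfspace[OF assms] by auto
qed

lemma halfspace_reduce:
  assumes a: "a \<in> Rmax_vecs"
    and a': "a' = (\<chi> i. if a $ i \<ge> b $ i then a $ i else - \<infinity>)"
    and b': "b' = (\<chi> j. if a $ j < b $ j then b $ j else - \<infinity>)"
  shows "halfspace a b = halfspace a' b'"
proof (intro set_eqI iffI)
  fix h assume h: "h \<in> halfspace a b"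
  obtain i where i: "tprod a h = a $ i + h $ i" by (rule tprod_attained)
  have "tprod a h \<le> tprod a' h"
  \<comment> \<open>If \<open>a'\<close> drops the maximizing index, then
    \<open>tprod a h = - \<infinity>\<close> and the bound is trivial; otherwise that term survives
    in \<open>a'\<close>.\<close>
  proof (cases "a $ i < b $ i")
    case True
    then show ?thesis
      using tprod_attained_imp_neg_inf[OF h i] i Rmax_vecs_nth[OF a, of i] by (simp add: add_neg_inf)
  next
    case False
    then show ?thesis using i tprod_ge[of a' i h] by (simp add: a' not_less)
  qed
  moreover have "tprod b' h \<le> tprod b h"
    by (rule tprod_mono) (simp add: b')
  ultimately show "h \<in> halfspace a' b'"
    using h by (auto simp: halfspace_def)
next
  fix h assume h: "h \<in> halfspace a' b'"
  have "tprod a' h \<le> tprod a h"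
    by (rule tprod_mono) (simp add: a')
  then have "tprod b' h \<le> tprod a h"
    using h by (auto simp: halfspace_def)
  \<comment> \<open>The term is either kept in \<open>b'\<close> or dominated by the corresponding
    term of \<open>a\<close>.\<close>
  then have "b $ j + h $ j \<le> tprod a h" for j
    using tprod_ge[of b' j h] tprod_ge[of a j h] add_right_mono[of "b $ j" "a $ j" "h $ j"]
    by (cases "a $ j < b $ j") (auto simp: b' not_less intro: order_trans)
  then show "h \<in> halfspace a b"
    using h by (simp add: halfspace_def tprod_le_iff)
qed

theorem proposition6p1:
  fixes a b a' b' :: "ereal ^ 'n"
  assumes "a \<in> Rmax_vecs" and "b \<in> Rmax_vecs"
    and "a \<noteq> neg_inf_vec" and "b \<noteq> neg_inf_vec"
    and "a' = (\<chi> i. if a $ i \<ge> b $ i then a $ i else - \<infinity>)"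
    and "b' = (\<chi> j. if a $ j < b $ j then b $ j else - \<infinity>)"
  shows "((\<not> a \<ge> b \<and> (\<exists>i. a $ i \<ge> b $ i)) \<longleftrightarrow>
            ({neg_inf_vec} \<noteq> halfspace a b \<and> halfspace a b \<noteq> Rmax_vecs)) \<and>
         (\<not> a \<ge> b \<and> (\<exists>i. a $ i \<ge> b $ i) \<longrightarrow>
            a' \<in> Rmax_vecs \<and> b' \<in> Rmax_vecs \<and>
            Supp a' \<inter> Supp b' = {} \<and>
            halfspace a b = halfspace a' b')"
proof (intro conjI impI)
  show "(\<not> a \<ge> b \<and> (\<exists>i. a $ i \<ge> b $ i)) \<longleftrightarrow>
          ({neg_inf_vec} \<noteq> halfspace a b \<and> halfspace a b \<noteq> Rmax_vecs)"
    \<comment> \<open>Each condition on \<open>a\<close> and \<open>b\<close> negates one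
      characterization: of the half-space being everything, and of its being trivial.\<close>
    using halfspace_eq_Rmax_vecs_iff[OF assms(1,2)] halfspace_eq_singleton_iff[OF assms(1,2)]
    by (metis linorder_not_le)
  show "a' \<in> Rmax_vecs" "b' \<in> Rmax_vecs"
    using assms(1,2) by (auto simp: assms(5,6) Rmax_vecs_def Rmax_def)
  \<comment> \<open>The two case conditions exclude each other, and \<open>- \<infinity>\<close> is
    not a real value.\<close>
  show "Supp a' \<inter> Supp b' = {}"
    by (auto simp: Supp_def assms(5,6) split: if_splits)
  show "halfspace a b = halfspace a' b'"
    using assms(1,5,6) by (rule halfspace_reduce)
qed

end
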